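(* Let $(\mathcal{R}_N)_{N\ge 0}$, $(\mathcal{L}_N)_{N\ge 1}$ be a factorization method for the sequence of selfadjoint operators $(\mathcal{D}_N)_{N\ge 0}$ on the spaces $(V_N)_{N\ge0}$, with constants $a_N,b_N$. Suppose that $\mathrm{Ker}\,\mathcal{L}_n$ is non trivial for $n\geq 0$ and choose $\varphi_n\in\mathrm{Ker}\,\mathcal{L}_n$, $\varphi_n\neq 0$. Set $f_{N,n}=\mathcal{R}_{N-1}\mathcal{R}_{N-2}\cdots\mathcal{R}_n\varphi_n$ for $0\le n\le N$. Then $$f_{N,0},f_{N,1},\dotsc,f_{N,n},\dotsc,f_{N,N-1},f_{N,N}$$ is a complete set of mutually orthogonal eigenvectors for $\mathcal{D}_N$, $N\ge 0$. Moreover we have $$\mathcal{R}_Nf_{N,n}=f_{N+1,n},\qquad \mathcal{L}_Nf_{N,n}=\left[\sum_{k=n}^{N-1}(b_k-a_k)\right]f_{N-1,n}.$$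
   Context: $V_0,V_1,V_2,\dotsc$ are finite dimensional complex vector spaces with $\dim V_N=N+1$, each endowed with an hermitian scalar product $\langle\cdot,\cdot\rangle_{V_N}$, and $\mathcal{D}_N:V_N\to V_N$ is a linear selfadjoint operator for each $N\ge 0$. A factorization method for $(\mathcal{D}_N)$ is given by two sequences of linear operators $\mathcal{R}_N:V_N\to V_{N+1}$ ($N\ge 0$) and $\mathcal{L}_N:V_N\to V_{N-1}$ ($N\ge 1$) such that: (i) $\langle\mathcal{R}_{N-1}f_1,f_2\rangle_{V_N}=\langle f_1,\mathcal{L}_Nf_2\rangle_{V_{N-1}}$ for all $f_1\in V_{N-1}$, $f_2\in V_N$, $N\ge1$; (ii) $\mathcal{R}_{N-1}\mathcal{L}_N=-\mathcal{D}_N+a_NI_N$ for $N\ge 1$; (iii) $\mathcal{L}_{N+1}\mathcal{R}_N=-\mathcal{D}_N+b_NI_N$ for $N\ge 0$, where $a_N,b_N$ are constants and $I_N$ is the identity operator on $V_N$. Conventions: $\mathcal{R}_{-1}=0$, $\mathcal{L}_0=0$, and $a_0$ is defined by $\mathcal{D}_0=a_0I_0$. The empty product of operators is the identity (so $f_{n,n}=\varphi_n$); for $n=N$ the sum in the second identity is empty and its right-hand side is read as $0$.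
   Formalization: The claim that the f_{N,n} are a complete set of (nonzero) eigenvectors of D_N is proved when a_k ≠ b_k for all k < N; otherwise some f_{N,k} = 0 (e.g. R = L = D = 0, a = b = 0) and it fails. Orthogonality, the eigenvalue equations and both identities need no such condition. *)

theory Defs
  imports Complex_Main
begin

text \<open>
  The spaces \<open>V N\<close> are subspaces of one complex vector space \<open>'v\<close>, which is no restriction since
  the direct sum of all of them is a possible \<open>'v\<close>.  Scalar products and operators are total
  functions of the logic, but nothing is required of them outside the spaces they belong to.
\<close>

definition hermitian_product_on ::
    "(complex \<Rightarrow> 'v::ab_group_add \<Rightarrow> 'v) \<Rightarrow> 'v set \<Rightarrow> ('v \<Rightarrow> 'v \<Rightarrow> complex) \<Rightarrow> bool" where
  "hermitian_product_on scale W ip \<longleftrightarrow>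
     (\<forall>x\<in>W. \<forall>y\<in>W. \<forall>z\<in>W. ip (x + y) z = ip x z + ip y z) \<and>
     (\<forall>c. \<forall>x\<in>W. \<forall>y\<in>W. ip (scale c x) y = c * ip x y) \<and>
     (\<forall>x\<in>W. \<forall>y\<in>W. ip x y = cnj (ip y x)) \<and>
     (\<forall>x\<in>W. x \<noteq> 0 \<longrightarrow> 0 < Re (ip x x))"

definition linear_operator ::
    "(complex \<Rightarrow> 'v::ab_group_add \<Rightarrow> 'v) \<Rightarrow> 'v set \<Rightarrow> 'v set \<Rightarrow> ('v \<Rightarrow> 'v) \<Rightarrow> bool" where
  "linear_operator scale W W' T \<longleftrightarrow>
     (\<forall>x\<in>W. T x \<in> W') \<and>
     (\<forall>x\<in>W. \<forall>y\<in>W. T (x + y) = T x + T y) \<and>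
     (\<forall>c. \<forall>x\<in>W. T (scale c x) = scale c (T x))"

definition selfadjoint_on :: "'v set \<Rightarrow> ('v \<Rightarrow> 'v \<Rightarrow> complex) \<Rightarrow> ('v \<Rightarrow> 'v) \<Rightarrow> bool" where
  "selfadjoint_on W ip T \<longleftrightarrow> (\<forall>x\<in>W. \<forall>y\<in>W. ip (T x) y = ip x (T y))"

definition kernel_on :: "'v::zero set \<Rightarrow> ('v \<Rightarrow> 'v) \<Rightarrow> 'v set" where
  "kernel_on W T = {x \<in> W. T x = 0}"

text \<open>Since \<open>dim\<close> is \<open>0\<close> on infinite-dimensional spaces, \<open>dim_V\<close> includes finite dimensionality.\<close>

locale selfadjoint_sequence = vector_space scale
  for scale :: "complex \<Rightarrow> 'v::ab_group_add \<Rightarrow> 'v" +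
  fixes V :: "nat \<Rightarrow> 'v set"
    and ip :: "nat \<Rightarrow> 'v \<Rightarrow> 'v \<Rightarrow> complex"
    and D :: "nat \<Rightarrow> 'v \<Rightarrow> 'v"
  assumes subspace_V: "subspace (V N)"
    and dim_V: "dim (V N) = N + 1"
    and hermitian_ip: "hermitian_product_on scale (V N) (ip N)"
    and linear_D: "linear_operator scale (V N) (V N) (D N)"
    and selfadjoint_D: "selfadjoint_on (V N) (ip N) (D N)"

text \<open>
  The operator \<open>L (Suc N)\<close> maps \<open>V (Suc N)\<close> to \<open>V N\<close>.  There is no space \<open>V\<close> of index \<open>-1\<close>:
  \<open>L_zero\<close> is the convention for the operator \<open>L\<close> of index \<open>0\<close>, and \<open>D_zero\<close> defines \<open>a 0\<close>.
\<close>

locale factorization_method = selfadjoint_sequence scale V ip D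
  for scale :: "complex \<Rightarrow> 'v::ab_group_add \<Rightarrow> 'v"
    and V :: "nat \<Rightarrow> 'v set"
    and ip :: "nat \<Rightarrow> 'v \<Rightarrow> 'v \<Rightarrow> complex"
    and D :: "nat \<Rightarrow> 'v \<Rightarrow> 'v" +
  fixes R L :: "nat \<Rightarrow> 'v \<Rightarrow> 'v"
    and a b :: "nat \<Rightarrow> complex"
  assumes linear_R: "linear_operator scale (V N) (V (Suc N)) (R N)"
    and linear_L: "linear_operator scale (V (Suc N)) (V N) (L (Suc N))"
    and adjoint: "x \<in> V N \<Longrightarrow> y \<in> V (Suc N) \<Longrightarrow> ip (Suc N) (R N x) y = ip N x (L (Suc N) y)"
    and R_L: "x \<in> V (Suc N) \<Longrightarrow> R N (L (Suc N) x) = - D (Suc N) x + scale (a (Suc N)) x"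
    and L_R: "x \<in> V N \<Longrightarrow> L (Suc N) (R N x) = - D N x + scale (b N) x"
    and L_zero: "x \<in> V 0 \<Longrightarrow> L 0 x = 0"
    and D_zero: "x \<in> V 0 \<Longrightarrow> D 0 x = scale (a 0) x"

text \<open>\<open>ladder_vector R \<phi> N n\<close> is \<open>R (N - 1) (R (N - 2) (\<dots> (R n (\<phi> n))))\<close> for \<open>n \<le> N\<close>.\<close>

definition ladder_vector :: "(nat \<Rightarrow> 'v \<Rightarrow> 'v) \<Rightarrow> (nat \<Rightarrow> 'v) \<Rightarrow> nat \<Rightarrow> nat \<Rightarrow> 'v" where
  "ladder_vector R \<phi> N n = fold R [n..<N] (\<phi> n)"

definition eigenvector_on ::
    "(complex \<Rightarrow> 'v::ab_group_add \<Rightarrow> 'v) \<Rightarrow> 'v set \<Rightarrow> ('v \<Rightarrow> 'v) \<Rightarrow> 'v \<Rightarrow> bool" where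
  "eigenvector_on scale W T v \<longleftrightarrow> v \<in> W \<and> v \<noteq> 0 \<and> (\<exists>\<mu>. T v = scale \<mu> v)"

definition mutually_orthogonal :: "('v \<Rightarrow> 'v \<Rightarrow> complex) \<Rightarrow> 'i set \<Rightarrow> ('i \<Rightarrow> 'v) \<Rightarrow> bool" where
  "mutually_orthogonal ip I v \<longleftrightarrow> (\<forall>i\<in>I. \<forall>j\<in>I. i \<noteq> j \<longrightarrow> ip (v i) (v j) = 0)"

definition complete_orthogonal_eigenvectors ::
    "(complex \<Rightarrow> 'v::ab_group_add \<Rightarrow> 'v) \<Rightarrow> 'v set \<Rightarrow> ('v \<Rightarrow> 'v \<Rightarrow> complex) \<Rightarrow> ('v \<Rightarrow> 'v) \<Rightarrow>
     'i set \<Rightarrow> ('i \<Rightarrow> 'v) \<Rightarrow> bool" where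
  "complete_orthogonal_eigenvectors scale W ip T I v \<longleftrightarrow>
     (\<forall>i\<in>I. eigenvector_on scale W T (v i)) \<and>
     mutually_orthogonal ip I v \<and>
     module.span scale (v ` I) = W"

text \<open>
  A factorization method may be degenerate, for instance \<open>R\<close>, \<open>L\<close>, \<open>D\<close>, \<open>a\<close>, \<open>b\<close> all zero.  If
  \<open>L k\<close> annihilates \<open>x\<close> then \<open>D k x = a k x\<close>, hence \<open>R k x\<close> has squared norm \<open>b k - a k\<close> times
  that of \<open>x\<close>.  Therefore \<open>ladder_vector R \<phi> (k + 1) k\<close>, and with it \<open>ladder_vector R \<phi> N k\<close>
  for all \<open>N > k\<close>, vanishes as soon as \<open>a k = b k\<close>.  The vectors of level \<open>N\<close> can be
  eigenvectors only if the following condition holds.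
\<close>

definition nondegenerate_below :: "(nat \<Rightarrow> complex) \<Rightarrow> (nat \<Rightarrow> complex) \<Rightarrow> nat \<Rightarrow> bool" where
  "nondegenerate_below a b N \<longleftrightarrow> (\<forall>k<N. a k \<noteq> b k)"

end

theory Submission
  imports Defs
begin

text \<open>
  The commutation relations give \<open>L f\<^sub>N\<^sub>,\<^sub>n = s f\<^sub>N\<^sub>-\<^sub>1\<^sub>,\<^sub>n\<close> with
  \<open>s = \<Sum>k=n..<N. b k - a k\<close> by induction on \<open>N\<close>, so the ladder vectors are eigenvectors.  Moving
  one \<open>R\<close> across the scalar product therefore lowers the level of a pair of ladder vectors by one,
  until one of them is \<open>\<phi>\<close> itself, which \<open>L\<close> annihilates: this gives orthogonality without
  comparing eigenvalues.  The same step gives \<open>\<parallel>f\<^sub>N\<^sub>,\<^sub>n\<parallel>\<^sup>2 = s \<parallel>f\<^sub>N\<^sub>-\<^sub>1\<^sub>,\<^sub>n\<parallel>\<^sup>2\<close>; for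
  \<open>n = N - 1\<close> it shows that \<open>b k - a k\<close> is real and nonnegative, so if none of these
  numbers vanishes then no \<open>s\<close> does, and \<open>N + 1\<close> nonzero orthogonal vectors span.
\<close>

section \<open>Bases and orthogonal families in a subspace\<close>

lemma (in vector_space) span_eq_if_independent_card_eq_dim:
  assumes "subspace W" "independent B" "B \<subseteq> W" "card B = dim W" "0 < dim W"
  shows "span B = W"
proof
  show "span B \<subseteq> W"
    using assms(1,3) by (rule span_minimal[rotated])
  show "W \<subseteq> span B"
  proof
    fix x assume x: "x \<in> W"
    obtain C where C: "C \<subseteq> W" "independent C" "W \<subseteq> span C" "card C = dim W"
      using basis_exists by blast
    have finC: "finite C" and finB: "finite B"
      \<comment> \<open>\<open>card\<close> is 0 on infinite sets, so positivity of the dimension is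
        what yields finiteness.\<close>
      using C(4) assms(4,5) by (auto intro: card_ge_0_finite)
    show "x \<in> span B"
    proof (rule ccontr)
      \<comment> \<open>Adding \<open>x\<close> would give \<open>dim W + 1\<close> independent
        vectors in the span of the \<open>dim W\<close> vectors of \<open>C\<close>.\<close>
      assume nx: "x \<notin> span B"
      then have "independent (insert x B)" "x \<notin> B"
        using assms(2) by (auto simp: independent_insert intro: span_base)
      moreover have "insert x B \<subseteq> span C"
        using x assms(3) C(3) by auto
      ultimately show False
        using independent_span_bound[OF finC] finB C(4) assms(4) by fastforce
    qed
  qed
qed

lemma hermitian_product_onD:
  assumes "hermitian_product_on scale W ip"
  shows "x \<in> W \<Longrightarrow> y \<in> W \<Longrightarrow> z \<in> W \<Longrightarrow> ip (x + y) z = ip x z + ip y z"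
    and "x \<in> W \<Longrightarrow> y \<in> W \<Longrightarrow> ip (scale c x) y = c * ip x y"
    and "x \<in> W \<Longrightarrow> y \<in> W \<Longrightarrow> ip x y = cnj (ip y x)"
    and "x \<in> W \<Longrightarrow> x \<noteq> 0 \<Longrightarrow> 0 < Re (ip x x)"
  using assms unfolding hermitian_product_on_def by blast+

lemma linear_operatorD:
  assumes "linear_operator scale W W' T"
  shows "x \<in> W \<Longrightarrow> T x \<in> W'"
    and "x \<in> W \<Longrightarrow> y \<in> W \<Longrightarrow> T (x + y) = T x + T y"
    and "x \<in> W \<Longrightarrow> T (scale c x) = scale c (T x)"
  using assms unfolding linear_operator_def by blast+

locale complex_vector_space = vector_space scale
  for scale :: "complex \<Rightarrow> 'v::ab_group_add \<Rightarrow> 'v"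
begin

lemma linear_operator_zero:
  assumes "linear_operator scale W W' T" "x \<in> W"
  shows "T 0 = 0"
  using linear_operatorD(3)[OF assms, of 0] by simp

lemma hermitian_product_scale_right:
  assumes "hermitian_product_on scale W ip" "subspace W" "x \<in> W" "y \<in> W"
  shows "ip x (scale c y) = cnj c * ip x y"
proof -
  have "ip x (scale c y) = cnj (ip (scale c y) x)"
    using assms subspace_scale by (intro hermitian_product_onD(3)) auto
  also have "\<dots> = cnj c * cnj (ip y x)"
    using hermitian_product_onD(2)[OF assms(1,4,3)] by simp
  also have "cnj (ip y x) = ip x y"
    using hermitian_product_onD(3)[OF assms(1,3,4)] by (rule sym)
  finally show ?thesis .
qed

lemma hermitian_product_zero_left:
  assumes "hermitian_product_on scale W ip" "y \<in> W"
  shows "ip 0 y = 0"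
  using hermitian_product_onD(2)[OF assms(1,2,2), of 0] by simp

lemma hermitian_product_zero_right:
  assumes "hermitian_product_on scale W ip" "subspace W" "x \<in> W"
  shows "ip x 0 = 0"
  using hermitian_product_scale_right[OF assms assms(3), of 0] by simp

text \<open>A member in the span of the others would be orthogonal to itself. Injectivity is
  recorded as well because completeness counts the image set, whose cardinality must be that of
  \<open>I\<close>.\<close>

lemma independent_if_mutually_orthogonal:
  assumes ip: "hermitian_product_on scale W ip" and W: "subspace W"
    and v: "v ` I \<subseteq> W" "\<And>i. i \<in> I \<Longrightarrow> v i \<noteq> 0"
    and orth: "mutually_orthogonal ip I v"
  shows "independent (v ` I)" "inj_on v I"
proof -
  show "independent (v ` I)"
    unfolding dependent_def
  proof
    assume "\<exists>x\<in>v ` I. x \<in> span (v ` I - {x})"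
    then obtain i where i: "i \<in> I" and span: "v i \<in> span (v ` I - {v i})"
      by blast
    have vi: "v i \<in> W"
      using i v by blast
    \<comment> \<open>The span of the other members stays inside this orthogonal complement; it is
      cut out of \<open>W\<close> because \<open>ip\<close> is controlled only there.\<close>
    have "subspace {y \<in> W. ip y (v i) = 0}"
      using vi W subspace_0[OF W] subspace_add[OF W] subspace_scale[OF W]
      by (auto intro!: subspaceI simp: hermitian_product_onD(1,2)[OF ip]
          hermitian_product_zero_left[OF ip])
    moreover have "v ` I - {v i} \<subseteq> {y \<in> W. ip y (v i) = 0}"
      using v(1) orth i unfolding mutually_orthogonal_def by auto
    ultimately have "ip (v i) (v i) = 0"
      using span_minimal span by blast
    then show False
      using hermitian_product_onD(4)[OF ip vi v(2)[OF i]] by simp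
  qed
  show "inj_on v I"
  proof (rule inj_onI, rule ccontr)
    fix i j assume ij: "i \<in> I" "j \<in> I" "v i = v j" "i \<noteq> j"
    then have "ip (v i) (v i) = 0"
      using orth unfolding mutually_orthogonal_def by metis
    then show False
      using hermitian_product_onD(4)[OF ip _ v(2)[OF ij(1)]] v(1) ij(1) by auto
  qed
qed

end

sublocale selfadjoint_sequence \<subseteq> complex_vector_space ..

section \<open>Ladder vectors: action of \<open>L\<close> and \<open>D\<close>,
  orthogonality\<close>

lemma ladder_vector_self: "ladder_vector R \<phi> n n = \<phi> n"
  by (simp add: ladder_vector_def)

lemma ladder_vector_Suc:
  "n \<le> N \<Longrightarrow> ladder_vector R \<phi> (Suc N) n = R N (ladder_vector R \<phi> N n)"
  by (simp add: ladder_vector_def)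

context factorization_method
begin

lemma ip_self_real_nonneg:
  assumes "x \<in> V N"
  shows "ip N x x = of_real (Re (ip N x x))" "0 \<le> Re (ip N x x)"
proof -
  have "ip N x x = cnj (ip N x x)"
    using hermitian_product_onD(3)[OF hermitian_ip assms assms] .
  then show "ip N x x = of_real (Re (ip N x x))"
    by (simp add: complex_eq_iff)
  show "0 \<le> Re (ip N x x)"
    using hermitian_product_onD(4)[OF hermitian_ip assms]
      hermitian_product_zero_left[OF hermitian_ip assms]
    by (cases "x = 0") (auto simp: less_imp_le)
qed

text \<open>On the kernel the relation \<open>R_L\<close> collapses, since \<open>R m 0 = 0\<close>.
  At index 0 there is no such relation and the convention \<open>D_zero\<close> takes its
  place.\<close>

lemma D_eq_scale_a:
  assumes "x \<in> kernel_on (V n) (L n)"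
  shows "D n x = scale (a n) x"
proof (cases n)
  case 0
  then show ?thesis
    using assms D_zero by (auto simp: kernel_on_def)
next
  case (Suc m)
  have "0 \<in> V m"
    using subspace_0[OF subspace_V] .
  then have "R m 0 = 0"
    using linear_operator_zero[OF linear_R] by blast
  then show ?thesis
    using assms R_L[of x m] Suc by (simp add: kernel_on_def)
qed

context
  fixes \<phi> :: "nat \<Rightarrow> 'v"
  assumes kernel: "\<And>n. \<phi> n \<in> kernel_on (V n) (L n)"
begin

lemma ladder_vector_in_V: "n \<le> N \<Longrightarrow> ladder_vector R \<phi> N n \<in> V N"
proof (induction N rule: dec_induct)
  case base
  show ?case
    using kernel by (simp add: ladder_vector_self kernel_on_def)
next
  case (step N)
  then show ?case
    using linear_operatorD(1)[OF linear_R] by (simp add: ladder_vector_Suc)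
qed

text \<open>Eliminating \<open>D (Suc N)\<close> between \<open>L_R\<close> and \<open>R_L\<close>
  shows that at level \<open>Suc N\<close> the composite \<open>L R\<close> is \<open>R L\<close>
  plus the scalar \<open>b (Suc N) - a (Suc N)\<close>, so each level adds one summand. The base
  case uses that \<open>D n\<close> acts on \<open>\<phi> n\<close> as \<open>a n\<close>.\<close>

lemma L_ladder_vector_Suc:
  "n \<le> N \<Longrightarrow> L (Suc N) (ladder_vector R \<phi> (Suc N) n)
     = scale (\<Sum>k=n..<Suc N. b k - a k) (ladder_vector R \<phi> N n)"
proof (induction N rule: dec_induct)
  case base
  have "\<phi> n \<in> V n"
    using kernel by (simp add: kernel_on_def)
  then show ?case
    using L_R D_eq_scale_a[OF kernel]
    by (simp add: ladder_vector_Suc ladder_vector_self scale_left_diff_distrib)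
next
  case (step N)
  let ?f = "ladder_vector R \<phi>" and ?s = "\<Sum>k=n..<Suc N. b k - a k"
  have V: "?f N n \<in> V N" "?f (Suc N) n \<in> V (Suc N)"
    using step.hyps ladder_vector_in_V by auto
  have "R N (L (Suc N) (?f (Suc N) n)) = scale ?s (?f (Suc N) n)"
    using step V linear_operatorD(3)[OF linear_R] by (simp add: ladder_vector_Suc)
  \<comment> \<open>\<open>R_L\<close> turns the induction hypothesis into an eigenvalue equation
    for \<open>D (Suc N)\<close>.\<close>
  then have D: "- D (Suc N) (?f (Suc N) n) = scale (?s - a (Suc N)) (?f (Suc N) n)"
    using R_L[OF V(2)] by (simp add: scale_left_diff_distrib algebra_simps)
  have "L (Suc (Suc N)) (?f (Suc (Suc N)) n)
      = - D (Suc N) (?f (Suc N) n) + scale (b (Suc N)) (?f (Suc N) n)"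
    using L_R[OF V(2)] step.hyps by (simp add: ladder_vector_Suc)
  also have "\<dots> = scale (?s - a (Suc N) + b (Suc N)) (?f (Suc N) n)"
    unfolding D scale_left_distrib ..
  also have "?s - a (Suc N) + b (Suc N) = (\<Sum>k=n..<Suc (Suc N). b k - a k)"
    using step.hyps by simp
  finally show ?case .
qed

lemma D_ladder_vector:
  assumes "n \<le> N"
  shows "D N (ladder_vector R \<phi> N n)
    = scale (b N - (\<Sum>k=n..<Suc N. b k - a k)) (ladder_vector R \<phi> N n)"
proof -
  have "scale (\<Sum>k=n..<Suc N. b k - a k) (ladder_vector R \<phi> N n)
      = - D N (ladder_vector R \<phi> N n) + scale (b N) (ladder_vector R \<phi> N n)"
    using L_ladder_vector_Suc[OF assms] L_R[OF ladder_vector_in_V[OF assms]] assms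
    by (simp add: ladder_vector_Suc)
  then show ?thesis
    by (simp add: scale_left_diff_distrib algebra_simps)
qed

lemma ip_ladder_vector_Suc:
  assumes "n \<le> N" "m \<le> N"
  shows "ip (Suc N) (ladder_vector R \<phi> (Suc N) n) (ladder_vector R \<phi> (Suc N) m)
    = cnj (\<Sum>k=m..<Suc N. b k - a k) * ip N (ladder_vector R \<phi> N n) (ladder_vector R \<phi> N m)"
proof -
  have "ip (Suc N) (ladder_vector R \<phi> (Suc N) n) (ladder_vector R \<phi> (Suc N) m)
      = ip N (ladder_vector R \<phi> N n) (L (Suc N) (ladder_vector R \<phi> (Suc N) m))"
    \<comment> \<open>Only the first argument is unfolded: its outermost \<open>R\<close> crosses
      the product, while the second stays a ladder vector for \<open>L\<close> to lower.\<close>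
    using assms adjoint ladder_vector_in_V by (simp add: ladder_vector_Suc[of n])
  also have "\<dots> = cnj (\<Sum>k=m..<Suc N. b k - a k)
      * ip N (ladder_vector R \<phi> N n) (ladder_vector R \<phi> N m)"
    unfolding L_ladder_vector_Suc[OF assms(2)]
    using assms ladder_vector_in_V
    by (intro hermitian_product_scale_right[OF hermitian_ip subspace_V]) auto
  finally show ?thesis .
qed

text \<open>Induction starts at level \<open>m\<close>, where the second vector is
  \<open>\<phi> m\<close>. As \<open>n < m\<close>, the first one still has an outer
  \<open>R\<close>, which becomes an \<open>L\<close> that annihilates
  \<open>\<phi> m\<close>.\<close>

lemma ladder_vector_orthogonal:
  assumes "n < m" "m \<le> N"
  shows "ip N (ladder_vector R \<phi> N n) (ladder_vector R \<phi> N m) = 0"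
  using assms(2)
proof (induction N rule: dec_induct)
  case base
  obtain M where M: "m = Suc M" "n \<le> M"
    using assms(1) by (cases m) auto
  have \<phi>: "\<phi> m \<in> V (Suc M)" "L (Suc M) (\<phi> m) = 0"
    using kernel[of m] M by (auto simp: kernel_on_def)
  have "ip (Suc M) (R M (ladder_vector R \<phi> M n)) (\<phi> m) = ip M (ladder_vector R \<phi> M n) 0"
    using adjoint[OF ladder_vector_in_V[OF M(2)] \<phi>(1)] \<phi>(2) by simp
  also have "\<dots> = 0"
    using hermitian_product_zero_right[OF hermitian_ip subspace_V ladder_vector_in_V[OF M(2)]] .
  finally show ?case
    using M by (simp add: ladder_vector_self ladder_vector_Suc)
next
  case (step N)
  then show ?case
    using ip_ladder_vector_Suc[of n N m] assms(1) by simp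
qed

lemma ladder_vectors_mutually_orthogonal:
  "mutually_orthogonal (ip N) {0..N} (ladder_vector R \<phi> N)"
  unfolding mutually_orthogonal_def
proof (intro ballI impI)
  fix i j assume ij: "i \<in> {0..N}" "j \<in> {0..N}" "i \<noteq> j"
  then have "ip N (ladder_vector R \<phi> N i) (ladder_vector R \<phi> N j)
      = cnj (ip N (ladder_vector R \<phi> N j) (ladder_vector R \<phi> N i))"
    by (intro hermitian_product_onD(3)[OF hermitian_ip] ladder_vector_in_V) auto
  then show "ip N (ladder_vector R \<phi> N i) (ladder_vector R \<phi> N j) = 0"
    using ij ladder_vector_orthogonal[of i j N] ladder_vector_orthogonal[of j i N]
    by (cases i j rule: linorder_cases) auto
qed

section \<open>Nonvanishing and completeness\<close>

context
  assumes nonzero: "\<And>n. \<phi> n \<noteq> 0"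
begin

text \<open>\<open>b n - a n\<close> is the quotient \<open>r / s\<close> of the squared norms of
  \<open>R n (\<phi> n)\<close> and \<open>\<phi> n\<close>.\<close>

lemma b_minus_a_nonneg: "b n - a n = of_real (Re (b n - a n))" "0 \<le> Re (b n - a n)"
proof -
  define r s where "r = Re (ip (Suc n) (ladder_vector R \<phi> (Suc n) n) (ladder_vector R \<phi> (Suc n) n))"
    and "s = Re (ip n (\<phi> n) (\<phi> n))"
  have \<phi>: "\<phi> n \<in> V n"
    using kernel by (simp add: kernel_on_def)
  have s: "0 < s"
    unfolding s_def using hermitian_product_onD(4)[OF hermitian_ip \<phi> nonzero] .
  have r: "0 \<le> r"
    unfolding r_def by (intro ip_self_real_nonneg ladder_vector_in_V) simp
  have "ip n (\<phi> n) (\<phi> n) = of_real s"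
    unfolding s_def using \<phi> by (rule ip_self_real_nonneg(1))
  moreover have "ip (Suc n) (ladder_vector R \<phi> (Suc n) n) (ladder_vector R \<phi> (Suc n) n) = of_real r"
    unfolding r_def by (intro ip_self_real_nonneg(1) ladder_vector_in_V) simp
  ultimately have "complex_of_real r = cnj (b n - a n) * complex_of_real s"
    using ip_ladder_vector_Suc[of n n n] by (simp add: ladder_vector_self)
  then have "cnj (b n - a n) = complex_of_real (r / s)"
    using s by (simp add: field_simps)
  then have "b n - a n = complex_of_real (r / s)"
    by (metis complex_cnj_cnj complex_cnj_complex_of_real)
  then show "b n - a n = of_real (Re (b n - a n))" "0 \<le> Re (b n - a n)"
    unfolding \<open>b n - a n = _\<close> using r s by simp_all
qed

text \<open>Under nondegeneracy each \<open>b k - a k\<close> below \<open>N\<close> is a positive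
  real, so partial sums cannot cancel. Thus \<open>L\<close> sends each new vector to a nonzero
  multiple of the previous one, which excludes 0.\<close>

lemma ladder_vector_nonzero:
  assumes "nondegenerate_below a b N" "n \<le> N"
  shows "ladder_vector R \<phi> N n \<noteq> 0"
  using assms(2,1)
proof (induction N rule: dec_induct)
  case base
  then show ?case
    by (simp add: ladder_vector_self nonzero)
next
  case (step N)
  let ?f = "ladder_vector R \<phi>"
  have "0 < Re (b k - a k)" if "k \<in> {n..<Suc N}" for k
  proof -
    have "b k - a k \<noteq> 0"
      using step.prems that by (auto simp: nondegenerate_below_def)
    then show ?thesis
      using b_minus_a_nonneg[of k] by (metis less_eq_real_def of_real_0)
  qed
  then have "0 < (\<Sum>k=n..<Suc N. Re (b k - a k))"
    using step.hyps by (intro sum_pos) auto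
  then have "Re (\<Sum>k=n..<Suc N. b k - a k) \<noteq> 0"
    unfolding Re_sum by linarith
  then have s: "(\<Sum>k=n..<Suc N. b k - a k) \<noteq> 0"
    by force
  have "?f N n \<noteq> 0"
    using step by (simp add: nondegenerate_below_def)
  then have "scale (\<Sum>k=n..<Suc N. b k - a k) (?f N n) \<noteq> 0"
    using s by (metis scale_eq_0_iff)
  then have "L (Suc N) (?f (Suc N) n) \<noteq> 0"
    using L_ladder_vector_Suc[OF step.hyps(1)] by metis
  moreover have "L (Suc N) 0 = 0"
    using linear_operator_zero[OF linear_L ladder_vector_in_V[of n "Suc N"]] step.hyps by simp
  ultimately show ?case
    by metis
qed

lemma ladder_vectors_complete:
  assumes "nondegenerate_below a b N"
  shows "complete_orthogonal_eigenvectors scale (V N) (ip N) (D N) {0..N} (ladder_vector R \<phi> N)"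
proof -
  let ?f = "ladder_vector R \<phi> N"
  have V: "?f ` {0..N} \<subseteq> V N"
    using ladder_vector_in_V by auto
  have nz: "?f i \<noteq> 0" if "i \<in> {0..N}" for i
    using ladder_vector_nonzero[OF assms] that by simp
  note ind = independent_if_mutually_orthogonal[OF hermitian_ip subspace_V V nz
      ladder_vectors_mutually_orthogonal]
  have "span (?f ` {0..N}) = V N"
    using V ind by (intro span_eq_if_independent_card_eq_dim)
      \<comment> \<open>Injectivity gives the image \<open>N + 1\<close> elements, which is
        \<open>dim (V N)\<close>.\<close>
      (simp_all add: subspace_V dim_V card_image)
  then show ?thesis
    using V nz D_ladder_vector ladder_vectors_mutually_orthogonal
    unfolding complete_orthogonal_eigenvectors_def eigenvector_on_def by auto
qed

end

end

end

theorem theorem2p7: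
  fixes scale :: "complex \<Rightarrow> 'v::ab_group_add \<Rightarrow> 'v"
    and V :: "nat \<Rightarrow> 'v set"
    and ip :: "nat \<Rightarrow> 'v \<Rightarrow> 'v \<Rightarrow> complex"
    and D R L :: "nat \<Rightarrow> 'v \<Rightarrow> 'v"
    and a b :: "nat \<Rightarrow> complex"
    and \<phi> :: "nat \<Rightarrow> 'v"
  assumes "factorization_method scale V ip D R L a b"
    and "\<And>n. kernel_on (V n) (L n) \<noteq> {0}"
    and "\<And>n. \<phi> n \<in> kernel_on (V n) (L n)"
    and "\<And>n. \<phi> n \<noteq> 0"
  shows "(\<forall>N. nondegenerate_below a b N \<longrightarrow>
            complete_orthogonal_eigenvectors scale (V N) (ip N) (D N) {0..N} (ladder_vector R \<phi> N))
       \<and> (\<forall>N. mutually_orthogonal (ip N) {0..N} (ladder_vector R \<phi> N))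
       \<and> (\<forall>N. \<forall>n\<le>N. \<exists>\<mu>. D N (ladder_vector R \<phi> N n) = scale \<mu> (ladder_vector R \<phi> N n))
       \<and> (\<forall>N. \<forall>n\<le>N. R N (ladder_vector R \<phi> N n) = ladder_vector R \<phi> (N + 1) n)
       \<and> (\<forall>N. \<forall>n<N. L N (ladder_vector R \<phi> N n)
            = scale (\<Sum>k=n..<N. b k - a k) (ladder_vector R \<phi> (N - 1) n))
       \<and> (\<forall>N. L N (ladder_vector R \<phi> N N) = 0)"
proof -
  interpret factorization_method scale V ip D R L a b
    by (rule assms(1))
  have "L N (ladder_vector R \<phi> N n) = scale (\<Sum>k=n..<N. b k - a k) (ladder_vector R \<phi> (N - 1) n)"
    if "n < N" for N n
    \<comment> \<open>From \<open>n < N\<close> it follows that \<open>N\<close> is positive, so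
      \<open>N - 1\<close> is a true predecessor and \<open>n \<le> N - 1\<close>.\<close>
    using that L_ladder_vector_Suc[OF assms(3), of n "N - 1"] by simp
  moreover have "L N (ladder_vector R \<phi> N N) = 0" for N
    using assms(3) by (simp add: ladder_vector_self kernel_on_def)
  moreover have "\<exists>\<mu>. D N (ladder_vector R \<phi> N n) = scale \<mu> (ladder_vector R \<phi> N n)"
    if "n \<le> N" for N n
    using D_ladder_vector[OF assms(3) that] by blast
  ultimately show ?thesis
    using ladder_vectors_complete[OF assms(3,4)] ladder_vectors_mutually_orthogonal[OF assms(3)]
    by (simp add: ladder_vector_Suc)
qed

end
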